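(* Let $\chi=(\mathfrak{B},\mathfrak{W})$ be a coloring of the plane such that $\mathfrak{B}$ is closed and $\mathfrak{W}$ is open. Then $\chi$ contains every triangle $T$.
   Context: A coloring is a partition of $\mathbb{R}^2$ into two disjoint sets $\mathfrak{B}$ and $\mathfrak{W}$. A triangle is any set of three points in the plane, including collinear triples. A set $X$ is a copy of a set $Y$ if $X$ can be obtained from $Y$ by translations and rotations of the plane. A set is monochromatic if it is contained in $\mathfrak{B}$ or in $\mathfrak{W}$. A coloring contains a triangle $T$ if some copy of $T$ is monochromatic. *)

theory Defs
  imports "HOL-Analysis.Analysis"
begin

type_synonym plane = "real ^ 2"

(* Collinear triples are allowed; the three points are distinct. *)
definition is_triangle :: "plane set \<Rightarrow> bool" where
  "is_triangle T \<longleftrightarrow> card T = 3"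

(* Compositions of translations and rotations about arbitrary centres are exactly the maps
   y \<mapsto> A y + a with A in SO(2); reflections are excluded. *)
definition is_copy :: "plane set \<Rightarrow> plane set \<Rightarrow> bool" where
  "is_copy X Y \<longleftrightarrow>
     (\<exists>(A :: real ^ 2 ^ 2) (a :: plane). rotation_matrix A \<and> X = (\<lambda>y. A *v y + a) ` Y)"

(* Either colour class may be empty. *)
definition coloring :: "plane set \<Rightarrow> plane set \<Rightarrow> bool" where
  "coloring B W \<longleftrightarrow> B \<union> W = UNIV \<and> B \<inter> W = {}"

definition monochromatic :: "plane set \<Rightarrow> plane set \<Rightarrow> plane set \<Rightarrow> bool" where
  "monochromatic B W X \<longleftrightarrow> X \<subseteq> B \<or> X \<subseteq> W"

definition contains_triangle :: "plane set \<Rightarrow> plane set \<Rightarrow> plane set \<Rightarrow> bool" where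
  "contains_triangle B W T \<longleftrightarrow> (\<exists>X. is_copy X T \<and> monochromatic B W X)"

end

theory Submission
  imports Defs
begin

text \<open>Suppose that no copy of \<open>T\<close> is monochromatic and let \<open>x\<close> be a black point that is a limit
  of white points. If a copy of \<open>T\<close> has a vertex at \<open>x\<close>, then its other two vertices have opposite
  colours: they are not both black, and if both were white, a small translation of the copy would be
  all white. Rotating about \<open>x\<close>, the angles at which one of these vertices is black form a closed
  set whose complement, the angles at which the other one is black, is closed as well. Hence each of
  the two circles about \<open>x\<close> that they trace is monochromatic, and the circles have opposite colours.
  Putting each vertex of \<open>T\<close> at \<open>x\<close> in turn, we obtain three circles about \<open>x\<close>, whose radii are the
  side lengths of \<open>T\<close>, with pairwise opposite colours, which is impossible for two colours.\<close>

definition rot :: "real \<Rightarrow> real ^ 2 ^ 2" where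
  "rot t = vector [vector [cos t, - sin t], vector [sin t, cos t]]"

lemma rotation_matrix_rot: "rotation_matrix (rot t)"
proof -
  have "transpose (rot t) ** rot t = mat 1"
    by (simp add: vec_eq_iff forall_2 matrix_matrix_mult_def transpose_def rot_def mat_def sum_2
        algebra_simps flip: power2_eq_square)
  moreover have "det (rot t) = 1"
    by (simp add: det_2 rot_def flip: power2_eq_square)
  ultimately show ?thesis
    by (simp add: rotation_matrix_def orthogonal_matrix)
qed

lemma rot_0: "rot 0 *v d = d"
  by (simp add: vec_eq_iff forall_2 matrix_vector_mult_def rot_def sum_2)

lemma rot_pi: "rot pi *v d = - d"
  by (simp add: vec_eq_iff forall_2 matrix_vector_mult_def rot_def sum_2)

lemma continuous_on_rot: "continuous_on UNIV (\<lambda>t. rot t *v d)"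
proof -
  have eq: "(\<lambda>t. rot t *v d) =
      (\<lambda>t. \<chi> i. if i = 1 then cos t * d $ 1 - sin t * d $ 2 else sin t * d $ 1 + cos t * d $ 2)"
    by (rule ext) (simp add: vec_eq_iff forall_2 matrix_vector_mult_def rot_def sum_2)
  have "continuous_on UNIV (\<lambda>t. if i = 1 then cos t * d $ 1 - sin t * d $ 2
      else sin t * d $ 1 + cos t * d $ 2)" for i :: 2
    by (cases "i = 1") (simp_all add: continuous_intros)
  then show ?thesis
    unfolding eq by (rule continuous_on_vec_lambda)
qed

lemma is_copy_refl: "is_copy T T"
  unfolding is_copy_def
  by (intro exI[of _ "mat 1"] exI[of _ 0]) (simp add: rotation_matrix_def orthogonal_matrix_id)

lemma is_copy_pinned:
  assumes "rotation_matrix A"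
  shows "is_copy {x, x + A *v (Q - P), x + A *v (R - P)} {P, Q, R}"
  \<comment> \<open>This translation part makes the rigid motion send \<open>P\<close> to
    \<open>x\<close>.\<close>
  unfolding is_copy_def using assms
  by (intro exI[of _ A] exI[of _ "x - A *v P"])
    (simp add: matrix_vector_mult_diff_distrib algebra_simps)

lemma coloring_boundary_point:
  fixes B W :: "plane set"
  assumes "coloring B W" "open W" "B \<noteq> {}" "W \<noteq> {}"
  shows "\<exists>x. x \<in> B \<and> x \<in> closure W"
proof (rule ccontr)
  assume "\<not> ?thesis"
  then have "closure W \<subseteq> W"
    using assms(1) by (auto simp: coloring_def)
  then have "closed W"
    by (metis closure_closed closure_subset subset_antisym closed_closure)
  then have "W = UNIV"
    using clopen[of W] assms by auto
  then show False
    using assms by (auto simp: coloring_def)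
qed

text \<open>The points \<open>y\<close> whose two translates lie in \<open>W\<close> form a
  neighbourhood of \<open>x\<close>, which therefore meets \<open>W\<close>.\<close>

lemma open_translates_meet:
  fixes W :: "'a::real_normed_vector set"
  assumes "open W" "x \<in> closure W" "x + d \<in> W" "x + e \<in> W"
  shows "\<exists>y\<in>W. y + d \<in> W \<and> y + e \<in> W"
proof -
  let ?U = "(\<lambda>y. y + d) -` W \<inter> (\<lambda>y. y + e) -` W"
  have "open ?U"
    by (intro open_Int open_vimage assms continuous_intros)
  moreover have "x \<in> ?U"
    using assms by simp
  ultimately show ?thesis
    using assms(2) by (auto simp: closure_iff_nhds_not_empty)
qed

context
  fixes B W :: "plane set" and x :: plane
  assumes col: "coloring B W" and B: "closed B" and W: "open W"
    and x: "x \<in> B" "x \<in> closure W"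
begin

lemma other_vertices_opposite:
  assumes no: "\<not> contains_triangle B W {P, Q, R}" and A: "rotation_matrix A"
  shows "x + A *v (Q - P) \<in> B \<longleftrightarrow> x + A *v (R - P) \<notin> B"
proof -
  \<comment> \<open>The base point stays free: the black case takes \<open>y = x\<close>, the white
    case a white \<open>y\<close> near \<open>x\<close>.\<close>
  have mono: "\<not> {y, y + A *v (Q - P), y + A *v (R - P)} \<subseteq> B"
    "\<not> {y, y + A *v (Q - P), y + A *v (R - P)} \<subseteq> W" for y
    using no is_copy_pinned[OF A, of y Q P R]
    unfolding contains_triangle_def monochromatic_def by blast+
  have "\<not> (x + A *v (Q - P) \<in> W \<and> x + A *v (R - P) \<in> W)"
    using open_translates_meet[OF W x(2)] mono(2) by blast
  moreover have "\<not> (x + A *v (Q - P) \<in> B \<and> x + A *v (R - P) \<in> B)"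
    using mono(1) x(1) by blast
  ultimately show ?thesis
    using col by (auto simp: coloring_def)
qed

text \<open>The side \<open>PQ\<close> leaves \<open>x\<close> as \<open>Q - P\<close> when
  \<open>P\<close> is placed there and as \<open>P - Q\<close> when \<open>Q\<close> is. These
  directions differ by a half turn on one monochromatic circle, so each side gets a single
  colour.\<close>

lemma antipodal_same_colour:
  assumes no: "\<not> contains_triangle B W {P, Q, R}"
  shows "x + (Q - P) \<in> B \<longleftrightarrow> x + (P - Q) \<in> B"
proof -
  define S where "S d = (\<lambda>t. x + rot t *v d) -` B" for d
  have closed_S: "closed (S d)" for d
    unfolding S_def by (intro closed_vimage B continuous_intros continuous_on_rot)
  have "S (Q - P) = - S (R - P)"
    unfolding S_def using other_vertices_opposite[OF no rotation_matrix_rot] by blast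
  then have "open (S (Q - P))"
    using closed_S by (simp add: open_Compl)
  then have "S (Q - P) = {} \<or> S (Q - P) = UNIV"
    using closed_S clopen by blast
  then have "0 \<in> S (Q - P) \<longleftrightarrow> pi \<in> S (Q - P)"
    by auto
  then show ?thesis
    by (simp add: S_def rot_0 rot_pi)
qed

lemma contains_triangle_boundary: "contains_triangle B W {P, Q, R}"
proof (rule ccontr)
  assume no: "\<not> ?thesis"
  have no': "\<not> contains_triangle B W {Q, P, R}" "\<not> contains_triangle B W {P, R, Q}"
    "\<not> contains_triangle B W {Q, R, P}" "\<not> contains_triangle B W {R, P, Q}"
    using no by (simp_all add: insert_commute)
  have opp: "x + (Q' - P') \<in> B \<longleftrightarrow> x + (R' - P') \<notin> B"
    if "\<not> contains_triangle B W {P', Q', R'}" for P' Q' R'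
    using other_vertices_opposite[OF that rotation_matrix_rot[of 0]] by (simp add: rot_0)
  \<comment> \<open>Any two sides of the triangle share a vertex, and \<open>opp\<close> at that
    vertex gives them opposite colours.\<close>
  show False
    using opp[OF no] opp[OF no'(1)] opp[OF no'(4)]
      antipodal_same_colour[OF no] antipodal_same_colour[OF no'(2)]
      antipodal_same_colour[OF no'(3)]
    by blast
qed

end

theorem theorem1:
  fixes B W :: "plane set"
  assumes "coloring B W" and "closed B" and "open W"
  shows "\<forall>T. is_triangle T \<longrightarrow> contains_triangle B W T"
proof (intro allI impI)
  fix T
  assume "is_triangle T"
  then obtain P Q R where T: "T = {P, Q, R}"
    by (auto simp: is_triangle_def card_3_iff)
  show "contains_triangle B W T"
  proof (cases "B = {} \<or> W = {}")
    case True
    then have "monochromatic B W T"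
      using assms(1) by (auto simp: coloring_def monochromatic_def)
    then show ?thesis
      using is_copy_refl by (auto simp: contains_triangle_def)
  next
    case False
    then obtain x where "x \<in> B" "x \<in> closure W"
      using coloring_boundary_point assms by blast
    then show ?thesis
      unfolding T using contains_triangle_boundary assms by blast
  qed
qed

end
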